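(* Let $n\ge1$. If $w\in\mathbb{Z}_+^n$ is a cyclic hyper degree, then $w\in H_n$, i.e. $w$ is the coordinate-wise sum of the elements of some subset of $\{0,1\}^n$ (equivalently, $w$ is the degree sequence of some simple hypergraph on vertex set $[n]$).
   Context: $\mathbb{Z}_+$ denotes the nonnegative integers. $H_n=\{\sum_{x\in S}x : S\subseteq\{0,1\}^n\}$ (the empty sum is the zero tuple). For $m\ge0$ and $i\ge1$, $\mathrm{bin}(m,i)$ is the $i$-th bit of $m$ counted from the least significant bit. For $i\in[n]$, $c_{i,n}$ is the list of length $2^n$ with $c_{i,n}(j)=\mathrm{bin}(j-1,i)$. A cyclic permutation of order $k\ge0$ on $[m]$ is the map $i\mapsto 1+((i+k-1)\bmod m)$. For a list $\Pi=(\pi_1,\dots,\pi_n)$ of cyclic permutations of $[2^n]$ and $i\in[2^n]$, let $\Pi(T_n,i)=(c_{n,n}(\pi_n(i)),c_{n-1,n}(\pi_{n-1}(i)),\dots,c_{1,n}(\pi_1(i)))\in\{0,1\}^n$. A tuple $d\in\mathbb{Z}_+^n$ is a cyclic hyper degree if there exist such a list $\Pi$ and indices $i\le N$ in $[2^n]$ with $d=\sum_{k=i}^{N}\Pi(T_n,k)$. *)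

theory Defs
  imports Main "HOL-Library.FuncSet"
begin

text \<open>
  An \<open>n\<close>-tuple over \<open>A\<close> is an element of \<open>{1..n} \<rightarrow>\<^sub>E A\<close>, so coordinates are numbered from \<open>1\<close> and
  equality of functions is equality of tuples.
\<close>

definition tuple_sum :: "nat \<Rightarrow> ('b \<Rightarrow> nat \<Rightarrow> nat) \<Rightarrow> 'b set \<Rightarrow> nat \<Rightarrow> nat" where
  "tuple_sum n f A = (\<lambda>j\<in>{1..n}. \<Sum>a\<in>A. f a j)"

definition H :: "nat \<Rightarrow> (nat \<Rightarrow> nat) set" where
  "H n = {tuple_sum n (\<lambda>x. x) S | S. S \<subseteq> ({1..n} \<rightarrow>\<^sub>E {0, 1})}"

text \<open>The library counts bits from \<open>0\<close>; here the least significant bit has index \<open>1\<close>.\<close>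

definition bin :: "nat \<Rightarrow> nat \<Rightarrow> nat" where
  "bin m i = of_bool (bit m (i - 1))"

definition col :: "nat \<Rightarrow> nat \<Rightarrow> nat \<Rightarrow> nat" where
  "col i n = (\<lambda>j\<in>{1..2 ^ n}. bin (j - 1) i)"

definition cyclic_perm :: "nat \<Rightarrow> nat \<Rightarrow> nat \<Rightarrow> nat" where
  "cyclic_perm m k = (\<lambda>i\<in>{1..m}. 1 + (i + k - 1) mod m)"

text \<open>Coordinate \<open>j\<close> is built from the column with index \<open>n + 1 - j\<close>: the tuple starts with column
  \<open>n\<close> and ends with column \<open>1\<close>.\<close>

definition shifted_row :: "nat \<Rightarrow> (nat \<Rightarrow> nat \<Rightarrow> nat) \<Rightarrow> nat \<Rightarrow> nat \<Rightarrow> nat" where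
  "shifted_row n \<pi> i = (\<lambda>j\<in>{1..n}. col (n + 1 - j) n (\<pi> (n + 1 - j) i))"

definition cyclic_hyper_degree :: "nat \<Rightarrow> (nat \<Rightarrow> nat) \<Rightarrow> bool" where
  "cyclic_hyper_degree n d \<longleftrightarrow>
     d \<in> ({1..n} \<rightarrow>\<^sub>E UNIV) \<and>
     (\<exists>\<pi> \<in> {1..n} \<rightarrow>\<^sub>E range (cyclic_perm (2 ^ n)).
        \<exists>i \<in> {1..2 ^ n}. \<exists>N \<in> {1..2 ^ n}. i \<le> N \<and> d = tuple_sum n (shifted_row n \<pi>) {i..N})"

text \<open>Members of \<open>H n\<close> are the degree sequences of the simple hypergraphs (sets of hyperedges)
  on the vertex set \<open>{1..n}\<close>.\<close>

lemma H_iff_degree_sequence: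
  "w \<in> H n \<longleftrightarrow> (\<exists>E \<subseteq> Pow {1..n}. w = (\<lambda>j\<in>{1..n}. card {e \<in> E. j \<in> e}))"
proof
  assume "w \<in> H n"
  then obtain S where S: "S \<subseteq> ({1..n} \<rightarrow>\<^sub>E {0, 1})" and w: "w = tuple_sum n (\<lambda>x. x) S"
    by (auto simp: H_def)
  have finS: "finite S"
    by (rule finite_subset[OF S]) (auto intro: finite_PiE)
  define g where "g x = {j \<in> {1..n}. x j = 1}" for x :: "nat \<Rightarrow> nat"
  have inj: "inj_on g S"
  proof (rule inj_onI)
    fix x y assume xy: "x \<in> S" "y \<in> S" and eq: "g x = g y"
    have x: "x \<in> {1..n} \<rightarrow>\<^sub>E {0, 1}" and y: "y \<in> {1..n} \<rightarrow>\<^sub>E {0, 1}" using S xy by blast+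
    show "x = y"
    proof (rule PiE_ext[OF x y])
      fix j assume j: "j \<in> {1..n}"
      have "x j \<in> {0, 1}" "y j \<in> {0, 1}" using PiE_mem[OF x j] PiE_mem[OF y j] .
      moreover have "x j = 1 \<longleftrightarrow> y j = 1" using eq j unfolding g_def by blast
      ultimately show "x j = y j" by auto
    qed
  qed
  have "(\<Sum>x\<in>S. x j) = card {e \<in> g ` S. j \<in> e}" if j: "j \<in> {1..n}" for j
  proof -
    have "(\<Sum>x\<in>S. x j) = (\<Sum>x\<in>S. of_bool (j \<in> g x))"
    proof (rule sum.cong[OF refl])
      fix x assume "x \<in> S"
      then have "x j \<in> {0, 1}" using S j by (meson PiE_mem subsetD)
      then show "x j = of_bool (j \<in> g x)" using j by (auto simp: g_def)
    qed
    also have "\<dots> = card {x \<in> S. j \<in> g x}"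
      using finS by (simp add: Int_def conj_commute)
    also have "\<dots> = card (g ` {x \<in> S. j \<in> g x})"
      by (rule card_image[symmetric], rule inj_on_subset[OF inj]) auto
    also have "g ` {x \<in> S. j \<in> g x} = {e \<in> g ` S. j \<in> e}" by auto
    finally show ?thesis .
  qed
  then have "w = (\<lambda>j\<in>{1..n}. card {e \<in> g ` S. j \<in> e})"
    unfolding w tuple_sum_def by (rule restrict_ext)
  moreover have "g ` S \<subseteq> Pow {1..n}" by (auto simp: g_def)
  ultimately show "\<exists>E \<subseteq> Pow {1..n}. w = (\<lambda>j\<in>{1..n}. card {e \<in> E. j \<in> e})" by blast
next
  assume "\<exists>E \<subseteq> Pow {1..n}. w = (\<lambda>j\<in>{1..n}. card {e \<in> E. j \<in> e})"
  then obtain E where E: "E \<subseteq> Pow {1..n}" and w: "w = (\<lambda>j\<in>{1..n}. card {e \<in> E. j \<in> e})" by blast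
  have finE: "finite E" using E by (rule finite_subset) simp
  define h :: "nat set \<Rightarrow> nat \<Rightarrow> nat" where "h e = (\<lambda>j\<in>{1..n}. of_bool (j \<in> e))" for e
  have inj: "inj_on h E"
  proof (rule inj_onI)
    fix e f assume ef: "e \<in> E" "f \<in> E" and eq: "h e = h f"
    have sub: "e \<subseteq> {1..n}" "f \<subseteq> {1..n}" using E ef by blast+
    have "j \<in> e \<longleftrightarrow> j \<in> f" if "j \<in> {1..n}" for j
    proof -
      have "of_bool (j \<in> e) = (of_bool (j \<in> f) :: nat)"
        using fun_cong[OF eq, of j] that by (simp add: h_def)
      then show ?thesis by (cases "j \<in> e"; cases "j \<in> f") auto
    qed
    with sub show "e = f" by (meson subsetD subset_antisym subsetI)
  qed
  have "card {e \<in> E. j \<in> e} = (\<Sum>x\<in>h ` E. x j)" if j: "j \<in> {1..n}" for j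
  proof -
    have "(\<Sum>x\<in>h ` E. x j) = (\<Sum>e\<in>E. h e j)" by (simp add: sum.reindex[OF inj])
    also have "\<dots> = (\<Sum>e\<in>E. of_bool (j \<in> e))" using j by (simp add: h_def)
    also have "\<dots> = card {e \<in> E. j \<in> e}"
      using finE by (simp add: Int_def conj_commute)
    finally show ?thesis by simp
  qed
  then have "w = tuple_sum n (\<lambda>x. x) (h ` E)"
    unfolding w tuple_sum_def by (rule restrict_ext)
  moreover have "h ` E \<subseteq> ({1..n} \<rightarrow>\<^sub>E {0, 1})" by (auto simp: h_def)
  ultimately show "w \<in> H n" unfolding H_def by blast
qed

end

theory Submission
  imports Defs "HOL-Number_Theory.Cong"
begin

text \<open>
  Within one period the rows \<open>\<Pi>(T\<^sub>n, k)\<close> are pairwise distinct, so a sum over an interval of indices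
  is the sum of a set of tuples. Indeed \<open>k\<close> can be recovered from its row one bit at a time: once
  \<open>k\<close> is known modulo \<open>2\<^sup>i\<close>, so is its shift in column \<open>i + 1\<close>, and the entry of that column
  is bit \<open>i\<close> of this shift, which determines \<open>k\<close> modulo \<open>2 * 2\<^sup>i\<close>.
\<close>

lemma cong_if_shifted_bits_eq:
  fixes a b :: nat and s :: "nat \<Rightarrow> nat"
  assumes "\<And>i. i < n \<Longrightarrow> bit (a + s i) i = bit (b + s i) i"
  shows "[a = b] (mod 2 ^ n)"
  using assms
proof (induction n)
  case 0
  show ?case by (simp add: cong_def)
next
  case (Suc m)
  from Suc have "[a = b] (mod 2 ^ m)" by simp
  \<comment> \<open>Adding the same shift to both numbers preserves their agreement in the low
    \<open>m\<close> bits. The hypothesis supplies bit \<open>m\<close>, after which the shift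
    cancels modulo \<open>2 ^ Suc m\<close>.\<close>
  then have "take_bit m (a + s m) = take_bit m (b + s m)"
    by (simp only: take_bit_eq_mod flip: cong_def) (simp only: cong_add_rcancel_nat)
  moreover have "bit (a + s m) m = bit (b + s m) m" using Suc.prems by simp
  ultimately have "take_bit (Suc m) (a + s m) = take_bit (Suc m) (b + s m)"
    by (simp add: take_bit_Suc_from_most)
  then have "[a + s m = b + s m] (mod 2 ^ Suc m)"
    by (simp only: take_bit_eq_mod cong_def)
  then show ?case by (simp only: cong_add_rcancel_nat)
qed

text \<open>The assumption keeps the argument of \<open>col\<close> in its domain; outside it the
  entry would be \<open>undefined\<close>.\<close>

lemma shifted_row_in_cube: "shifted_row n \<pi> k \<in> {1..n} \<rightarrow>\<^sub>E {0, 1}"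
  if "\<And>i. i \<in> {1..n} \<Longrightarrow> \<pi> i k \<in> {1..2 ^ n}"
proof (rule PiE_I)
  fix j assume j: "j \<in> {1..n}"
  then have "n + 1 - j \<in> {1..n}" by auto
  then have "\<pi> (n + 1 - j) k \<in> {1..2 ^ n}" by (rule that)
  with j show "shifted_row n \<pi> k j \<in> {0, 1}"
    by (simp add: shifted_row_def col_def bin_def)
qed (auto simp: shifted_row_def)

lemma cyclic_perm_in_range:
  assumes "k \<in> {1..m}"
  shows "cyclic_perm m s k \<in> {1..m}"
proof -
  from assms have "(k + s - 1) mod m < m" by simp
  then show ?thesis using assms by (simp add: cyclic_perm_def Suc_le_eq)
qed

text \<open>Wrapping around is invisible: reduction modulo \<open>2 ^ n\<close> leaves the bits
  below \<open>n\<close> unchanged. The offset 1 of the permutation cancels against the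
  \<open>j - 1\<close> in \<open>col\<close>.\<close>

lemma col_cyclic_perm:
  assumes "i < n" and "k \<in> {1..2 ^ n}"
  shows "col (Suc i) n (cyclic_perm (2 ^ n) s k) = of_bool (bit (k - 1 + s) i)"
proof -
  have "k + s - 1 = k - 1 + s" using assms(2) by simp
  then have perm: "cyclic_perm (2 ^ n) s k = 1 + (k - 1 + s) mod 2 ^ n"
    using assms(2) by (simp only: cyclic_perm_def restrict_apply' if_True)
  have "bit ((k - 1 + s) mod 2 ^ n) i = bit (k - 1 + s) i"
    using assms(1) by (simp only: bit_take_bit_iff simp_thms flip: take_bit_eq_mod)
  moreover have "1 + (k - 1 + s) mod 2 ^ n \<in> {1..2 ^ n}"
    using cyclic_perm_in_range[OF assms(2), of s] by (simp only: perm)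
  ultimately show ?thesis
    by (simp only: perm col_def bin_def restrict_apply' if_True add_diff_cancel_left' diff_Suc_1)
qed

lemma inj_on_shifted_row:
  assumes \<pi>: "\<And>i. i \<in> {1..n} \<Longrightarrow> \<pi> i = cyclic_perm (2 ^ n) (s i)"
  shows "inj_on (shifted_row n \<pi>) {1..2 ^ n}"
proof (rule inj_onI)
  fix a b :: nat
  assume ab: "a \<in> {1..2 ^ n}" "b \<in> {1..2 ^ n}" and eq: "shifted_row n \<pi> a = shifted_row n \<pi> b"
  have "bit (a - 1 + s (Suc i)) i = bit (b - 1 + s (Suc i)) i" if i: "i < n" for i
  proof -
    \<comment> \<open>Columns are listed in reverse, so column \<open>Suc i\<close>, which carries
      bit \<open>i\<close>, sits at coordinate \<open>n - i\<close>.\<close>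
    have "shifted_row n \<pi> k (n - i) = of_bool (bit (k - 1 + s (Suc i)) i)"
      if k: "k \<in> {1..2 ^ n}" for k
    proof -
      have "n + 1 - (n - i) = Suc i" "n - i \<in> {1..n}" "Suc i \<in> {1..n}" using i by auto
      then show ?thesis
        by (simp add: shifted_row_def \<pi> col_cyclic_perm[OF i k])
    qed
    from this[OF ab(1)] this[OF ab(2)] eq show ?thesis by (simp add: of_bool_eq_iff)
  qed
  then have "[a - 1 = b - 1] (mod 2 ^ n)"
    by (rule cong_if_shifted_bits_eq[where s = "\<lambda>i. s (Suc i)"])
  \<comment> \<open>Both numbers are least residues, so congruence becomes equality.\<close>
  moreover have "a - 1 < 2 ^ n" "b - 1 < 2 ^ n" using ab by auto
  ultimately have "a - 1 = b - 1" by (simp add: cong_def)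
  with ab show "a = b" by auto
qed

text \<open>Injectivity ensures that passing to the image, a set, merges no equal summands.\<close>

lemma tuple_sum_image:
  assumes "inj_on f A"
  shows "tuple_sum n f A = tuple_sum n (\<lambda>x. x) (f ` A)"
  by (simp add: tuple_sum_def sum.reindex[OF assms])

theorem theorem8:
  fixes n :: nat and w :: "nat \<Rightarrow> nat"
  assumes "n \<ge> 1" and "cyclic_hyper_degree n w"
  shows "w \<in> H n"
proof -
  from assms(2) obtain \<pi> i N
    where \<pi>: "\<pi> \<in> {1..n} \<rightarrow>\<^sub>E range (cyclic_perm (2 ^ n))"
      and iN: "i \<in> {1..2 ^ n}" "N \<in> {1..2 ^ n}"
      and w: "w = tuple_sum n (shifted_row n \<pi>) {i..N}"
    unfolding cyclic_hyper_degree_def by blast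
  from \<pi> have "\<forall>j\<in>{1..n}. \<exists>k. \<pi> j = cyclic_perm (2 ^ n) k" by blast
  then obtain s where s: "\<And>j. j \<in> {1..n} \<Longrightarrow> \<pi> j = cyclic_perm (2 ^ n) (s j)" by metis
  \<comment> \<open>The interval stays within a single period, where rows do not repeat.\<close>
  have sub: "{i..N} \<subseteq> {1..2 ^ n}" using iN by auto
  have "inj_on (shifted_row n \<pi>) {i..N}"
    using inj_on_shifted_row[OF s] sub by (rule inj_on_subset)
  then have "w = tuple_sum n (\<lambda>x. x) (shifted_row n \<pi> ` {i..N})"
    unfolding w by (rule tuple_sum_image)
  moreover have "shifted_row n \<pi> k \<in> {1..n} \<rightarrow>\<^sub>E {0, 1}" if "k \<in> {i..N}" for k
  proof (rule shifted_row_in_cube)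
    fix j assume "j \<in> {1..n}"
    then show "\<pi> j k \<in> {1..2 ^ n}"
      using cyclic_perm_in_range[of k "2 ^ n" "s j"] s that sub by auto
  qed
  then have "shifted_row n \<pi> ` {i..N} \<subseteq> {1..n} \<rightarrow>\<^sub>E {0, 1}" by (rule image_subsetI)
  ultimately show ?thesis unfolding H_def by (intro CollectI exI conjI)
qed

end
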